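(* There is a constant $\hat C_\mu\in\mathbb{R}$ such that for all $f\in C^1(\Omega)$ $$\mathrm{Var}_\mu(f)\le\hat C_\mu\int_\Omega|\nabla f|^2\,\alpha\,d\lambda .$$
   Context: Setting and notation. $\Omega$ is a smooth compact connected Riemannian manifold of dimension $d\ge2$ with smooth connected boundary $\partial\Omega$ (the boundary is included in $\Omega$). $\lambda$ is the volume measure on $\Omega$, $\sigma$ the Hausdorff (surface) measure on $\partial\Omega$, $\nabla$ the gradient on $\Omega$, $\nabla^\tau$ the tangential gradient on $\partial\Omega$. $C^1(\Omega)$ denotes functions that are $C^1$ up to the boundary; integrals over $\partial\Omega$ of functions on $\Omega$ use their restriction (trace). $\alpha,\beta:\Omega\to\mathbb{R}$ are weights, $A:=\int_\Omega\alpha\,d\lambda$, $B:=\int_{\partial\Omega}\beta\,d\sigma$, $d\lambda_\alpha:=\frac{\alpha}{A}d\lambda$, $d\sigma_\beta:=\frac{\beta}{B}d\sigma$, $d\mu:=\alpha\,d\lambda+\beta\,d\sigma$. For a probability measure $\nu$: $\mathrm{Var}_\nu(f)=\int f^2d\nu-(\int f\,d\nu)^2$ and $\mathrm{Ent}_\nu(f^2)=\int f^2\ln(f^2)d\nu-\int f^2d\nu\,\ln\int f^2d\nu$. Standing assumptions. (1) $\mu$ is a probability measure, with $A,B\in(0,1)$, $A+B=1$. (2) $\alpha,\beta\in C(\Omega)$, $\alpha>0$ $\lambda$-a.e. on $\Omega$, $\beta>0$ $\sigma$-a.e. on $\partial\Omega$, $\sqrt\alpha\in W^{1,2}(\Omega)$,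 $\sqrt\beta\in W^{1,2}(\partial\Omega)$ (the last condition is not used in the present case without boundary diffusion). (3) The constants $C_{\lambda_\alpha},L_{\lambda_\alpha},C_{\sigma_\beta},L_{\sigma_\beta}$ are finite, where these are the smallest constants with $\mathrm{Var}_{\lambda_\alpha}(f)\le C_{\lambda_\alpha}\int_\Omega|\nabla f|^2d\lambda_\alpha$ and $\mathrm{Ent}_{\lambda_\alpha}(f^2)\le L_{\lambda_\alpha}\int_\Omega|\nabla f|^2d\lambda_\alpha$ for all $f\in C^1(\Omega)$, and $\mathrm{Var}_{\sigma_\beta}(f)\le C_{\sigma_\beta}\int_{\partial\Omega}|\nabla^\tau f|^2d\sigma_\beta$ and $\mathrm{Ent}_{\sigma_\beta}(f^2)\le L_{\sigma_\beta}\int_{\partial\Omega}|\nabla^\tau f|^2d\sigma_\beta$ for all $f\in C^1(\partial\Omega)$. (4) The following embeddings/traces hold: $W^{1,2}(\Omega,\alpha d\lambda)\to L^2(\Omega,\alpha d\lambda)$ compactly; $W^{1,2}(\Omega,\alpha d\lambda)\to L^p(\Omega,\beta d\lambda)$ for $p\in[2,\frac{2d-2}{d-2}]$; $W^{1,2}(\partial\Omega,\beta d\sigma)\to L^2(\partial\Omega,\beta d\sigma)$ compactly; the trace $W^{1,2}(\Omega,\alpha d\lambda)\to L^2(\partial\Omega,\beta d\sigma)$ compactly. *)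

theory Defs
  imports "HOL-Probability.Probability"
begin

section \<open>Differentiability up to the boundary\<close>

text \<open>
  \<open>Ck_on k S f\<close>: \<open>f\<close> is of class \<open>C\<^sup>k\<close> on \<open>S\<close>. Derivatives are taken within \<open>S\<close>; below, \<open>S\<close> is a
  relatively open subset of a closed half-space (so the derivatives are unique and one-sided at
  the boundary) or of a hyperplane. In the latter case the derivative is unique only in directions
  tangent to the hyperplane, and it may be extended freely in the normal direction.
\<close>

primrec Ck_on :: "nat \<Rightarrow> 'a::real_normed_vector set \<Rightarrow> ('a \<Rightarrow> 'b::real_normed_vector) \<Rightarrow> bool" where
  "Ck_on 0 S f \<longleftrightarrow> continuous_on S f"
| "Ck_on (Suc k) S f \<longleftrightarrow>
     (\<exists>f'. (\<forall>x\<in>S. (f has_derivative f' x) (at x within S)) \<and> (\<forall>v. Ck_on k S (\<lambda>x. f' x v)))"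

definition smooth_on :: "'a::real_normed_vector set \<Rightarrow> ('a \<Rightarrow> 'b::real_normed_vector) \<Rightarrow> bool" where
  "smooth_on S f \<longleftrightarrow> (\<forall>k. Ck_on k S f)"


section \<open>Riemannian manifolds with boundary\<close>

text \<open>
  The model space is the closed half-space of \<open>real^'n\<close> on which one fixed coordinate is
  nonnegative; the dimension of the manifold is \<open>CARD('n)\<close>.
\<close>

definition normal_index :: "'n::finite" where
  "normal_index = (SOME i. True)"

definition half_space :: "(real^'n::finite) set" where
  "half_space = {x. 0 \<le> x $ normal_index}"

type_synonym ('m, 'n) chart = "'m set \<times> ('m \<Rightarrow> real^'n)"

definition chart_inv :: "('m, 'n::finite) chart \<Rightarrow> real^'n \<Rightarrow> 'm" where
  "chart_inv c = inv_into (fst c) (snd c)"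

definition is_chart :: "'m::topological_space set \<Rightarrow> ('m, 'n::finite) chart \<Rightarrow> bool" where
  "is_chart X c \<longleftrightarrow>
     openin (top_of_set X) (fst c) \<and>
     openin (top_of_set half_space) (snd c ` fst c) \<and>
     homeomorphism (fst c) (snd c ` fst c) (snd c) (chart_inv c)"

definition smooth_atlas :: "'m::topological_space set \<Rightarrow> ('m, 'n::finite) chart set \<Rightarrow> bool" where
  "smooth_atlas X \<A> \<longleftrightarrow>
     (\<forall>c\<in>\<A>. is_chart X c) \<and> (\<Union>c\<in>\<A>. fst c) = X \<and>
     (\<forall>c\<in>\<A>. \<forall>c'\<in>\<A>. smooth_on (snd c ` (fst c \<inter> fst c')) (snd c' \<circ> chart_inv c))"

text \<open>The differential at \<open>p\<close> of the change of coordinates from \<open>c\<close> to \<open>c'\<close>.\<close>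

definition transition_deriv ::
    "('m, 'n::finite) chart \<Rightarrow> ('m, 'n) chart \<Rightarrow> 'm \<Rightarrow> real^'n \<Rightarrow> real^'n" where
  "transition_deriv c c' p =
     frechet_derivative (snd c' \<circ> chart_inv c) (at (snd c p) within snd c ` (fst c \<inter> fst c'))"

text \<open>
  One record type represents both a Riemannian manifold with boundary and its boundary with the
  induced metric. A chart \<open>(U, \<phi>)\<close> is understood to be restricted to \<open>U \<inter> points\<close>, and the tangent
  space at \<open>p\<close>, seen through \<open>\<phi>\<close>, consists of the vectors supported on the coordinates in
  \<open>directions\<close>: all coordinates for the manifold, all but \<open>normal_index\<close> for its boundary.
  The bilinear form \<open>metric c p\<close> is the metric tensor at \<open>p\<close> in the coordinates of the chart \<open>c\<close>.
\<close>

record ('m, 'n::finite) riem =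
  points :: "'m set"
  charts :: "('m, 'n) chart set"
  metric :: "('m, 'n) chart \<Rightarrow> 'm \<Rightarrow> real^'n \<Rightarrow> real^'n \<Rightarrow> real"
  directions :: "'n set"

definition riemannian_manifold :: "('m::topological_space, 'n::finite) riem \<Rightarrow> bool" where
  "riemannian_manifold M \<longleftrightarrow>
     smooth_atlas (points M) (charts M) \<and> directions M = UNIV \<and>
     (\<forall>c\<in>charts M.
        (\<forall>p\<in>fst c. bilinear (metric M c p) \<and>
           (\<forall>v w. metric M c p v w = metric M c p w v) \<and>
           (\<forall>v. v \<noteq> 0 \<longrightarrow> 0 < metric M c p v v)) \<and>
        (\<forall>v w. smooth_on (snd c ` fst c) (\<lambda>x. metric M c (chart_inv c x) v w))) \<and>
     (\<forall>c\<in>charts M. \<forall>c'\<in>charts M. \<forall>p\<in>fst c \<inter> fst c'. \<forall>v w.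
        metric M c p v w =
          metric M c' p (transition_deriv c c' p v) (transition_deriv c c' p w))"

definition boundary_points :: "('m, 'n::finite) riem \<Rightarrow> 'm set" where
  "boundary_points M = {p. \<exists>c\<in>charts M. p \<in> fst c \<and> snd c p $ normal_index = 0}"

definition boundary :: "('m, 'n::finite) riem \<Rightarrow> ('m, 'n) riem" where
  "boundary M = M\<lparr>points := boundary_points M, directions := UNIV - {normal_index}\<rparr>"

definition chart_image :: "('m, 'n::finite) riem \<Rightarrow> ('m, 'n) chart \<Rightarrow> (real^'n) set" where
  "chart_image M c = snd c ` (fst c \<inter> points M)"

definition tangent_vectors :: "('m, 'n::finite) riem \<Rightarrow> (real^'n) set" where
  "tangent_vectors M = {v. \<forall>i. i \<notin> directions M \<longrightarrow> v $ i = 0}"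


section \<open>Volume measure\<close>

text \<open>
  Lebesgue measure on the coordinate subspace spanned by the directions in \<open>K\<close>, viewed as a
  measure on \<open>real^'n\<close>; it is \<open>lborel\<close> for \<open>K = UNIV\<close>.
\<close>

definition coordinate_lborel :: "'n set \<Rightarrow> (real^'n::finite) measure" where
  "coordinate_lborel K =
     distr (PiM K (\<lambda>_. lborel)) borel (\<lambda>y. \<chi> i. if i \<in> K then y i else 0)"

text \<open>
  Padding the Gram matrix with an identity block does not change its determinant, so this is the
  determinant of the metric coefficients indexed by \<open>directions M\<close>.
\<close>

definition metric_det :: "('m, 'n::finite) riem \<Rightarrow> ('m, 'n) chart \<Rightarrow> 'm \<Rightarrow> real" where
  "metric_det M c p =
     det (\<chi> i j. if i \<in> directions M \<and> j \<in> directions M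
                  then metric M c p (axis i 1) (axis j 1)
                  else if i = j then 1 else 0)"

text \<open>
  The Riemannian volume measure: the unique Borel measure that is \<open>sqrt (det g) dx\<close> in every chart.
  Applied to \<open>boundary M\<close>, this is the surface measure of the boundary, that is, the Hausdorff
  measure of dimension \<open>CARD('n) - 1\<close>.
\<close>

definition volume_measure :: "('m::topological_space, 'n::finite) riem \<Rightarrow> 'm measure \<Rightarrow> bool" where
  "volume_measure M \<nu> \<longleftrightarrow>
     sets \<nu> = sets (restrict_space borel (points M)) \<and>
     (\<forall>c\<in>charts M. \<forall>E\<in>sets \<nu>. E \<subseteq> fst c \<longrightarrow>
        emeasure \<nu> E =
          (\<integral>\<^sup>+x\<in>snd c ` E. ennreal (sqrt (metric_det M c (chart_inv c x)))
             \<partial>coordinate_lborel (directions M)))"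


section \<open>Functions of class C1, vector fields and gradients\<close>

definition C1 :: "('m, 'n::finite) riem \<Rightarrow> ('m \<Rightarrow> real) set" where
  "C1 M = {f. \<forall>c\<in>charts M. Ck_on 1 (chart_image M c) (f \<circ> chart_inv c)}"

text \<open>A vector field is given by its components \<open>V c p\<close> in each chart \<open>c\<close>.\<close>

type_synonym ('m, 'n) field = "('m, 'n) chart \<Rightarrow> 'm \<Rightarrow> real^'n"

definition tangent_field :: "('m, 'n::finite) riem \<Rightarrow> ('m, 'n) field \<Rightarrow> bool" where
  "tangent_field M V \<longleftrightarrow>
     (\<forall>c\<in>charts M. \<forall>p\<in>fst c \<inter> points M. V c p \<in> tangent_vectors M \<and>
        (\<forall>c'\<in>charts M. p \<in> fst c' \<longrightarrow> V c' p = transition_deriv c c' p (V c p)))"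

text \<open>
  The squared length \<open>|V p|\<^sup>2\<close>. For a tangent field it does not depend on the selected chart.
\<close>

definition field_normsq :: "('m, 'n::finite) riem \<Rightarrow> ('m, 'n) field \<Rightarrow> 'm \<Rightarrow> real" where
  "field_normsq M V p =
     (let c = (SOME c. c \<in> charts M \<and> p \<in> fst c) in metric M c p (V c p) (V c p))"

text \<open>
  The Riemannian gradient on \<open>M\<close>. On \<open>boundary M\<close> it is the tangential gradient, since only
  derivatives along \<open>tangent_vectors (boundary M)\<close> enter.
\<close>

definition gradient :: "('m, 'n::finite) riem \<Rightarrow> ('m \<Rightarrow> real) \<Rightarrow> ('m, 'n) field" where
  "gradient M f c p =
     (THE v. v \<in> tangent_vectors M \<and>
        (\<forall>w\<in>tangent_vectors M. metric M c p v w =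
           frechet_derivative (f \<circ> chart_inv c) (at (snd c p) within chart_image M c) w))"

abbreviation grad_sq :: "('m, 'n::finite) riem \<Rightarrow> ('m \<Rightarrow> real) \<Rightarrow> 'm \<Rightarrow> real" where
  "grad_sq M f \<equiv> field_normsq M (gradient M f)"


section \<open>Lebesgue and Sobolev spaces\<close>

text \<open>The measure \<open>w d\<nu>\<close>; \<open>ennreal\<close> takes the positive part, which is \<open>w\<close> for a nonnegative weight.\<close>

definition weighted :: "'m measure \<Rightarrow> ('m \<Rightarrow> real) \<Rightarrow> 'm measure" where
  "weighted \<nu> w = density \<nu> (\<lambda>x. ennreal (w x))"

definition Lp :: "real \<Rightarrow> 'm measure \<Rightarrow> ('m \<Rightarrow> real) set" where
  "Lp p \<nu> = {u \<in> borel_measurable \<nu>. integrable \<nu> (\<lambda>x. \<bar>u x\<bar> powr p)}"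

definition Lp_norm :: "real \<Rightarrow> 'm measure \<Rightarrow> ('m \<Rightarrow> real) \<Rightarrow> real" where
  "Lp_norm p \<nu> u = (\<integral>x. \<bar>u x\<bar> powr p \<partial>\<nu>) powr (1 / p)"

definition L2_field :: "('m::topological_space, 'n::finite) riem \<Rightarrow> 'm measure \<Rightarrow> ('m, 'n) field set" where
  "L2_field M \<nu> = {V. tangent_field M V \<and>
     (\<forall>c\<in>charts M. V c \<in> borel_measurable (restrict_space borel (fst c \<inter> points M))) \<and>
     integrable \<nu> (field_normsq M V)}"

text \<open>
  The Sobolev space \<open>W\<^sup>1\<^sup>,\<^sup>2(M, \<nu>)\<close>: the closure of the \<open>C\<^sup>1\<close> functions for the norm \<open>W12_norm\<close>. An element
  is represented by a function together with its gradient, that is, by a point of the closure of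
  the graph of \<open>gradient M\<close> in \<open>L\<^sup>2\<close>; thus no closability of the gradient is presupposed.
\<close>

definition W12 :: "('m::topological_space, 'n::finite) riem \<Rightarrow> 'm measure
    \<Rightarrow> (('m \<Rightarrow> real) \<times> ('m, 'n) field) set" where
  "W12 M \<nu> = {(u, V). u \<in> Lp 2 \<nu> \<and> V \<in> L2_field M \<nu> \<and>
     (\<exists>f. (\<forall>k::nat. f k \<in> C1 M) \<and>
        (\<lambda>k. \<integral>\<^sup>+x. ennreal ((f k x - u x)\<^sup>2) \<partial>\<nu>) \<longlonglongrightarrow> 0 \<and>
        (\<lambda>k. \<integral>\<^sup>+x. ennreal (field_normsq M (\<lambda>c p. gradient M (f k) c p - V c p) x) \<partial>\<nu>) \<longlonglongrightarrow> 0)}"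

definition W12_norm :: "('m, 'n::finite) riem \<Rightarrow> 'm measure
    \<Rightarrow> ('m \<Rightarrow> real) \<times> ('m, 'n) field \<Rightarrow> real" where
  "W12_norm M \<nu> w = sqrt ((\<integral>x. (fst w x)\<^sup>2 \<partial>\<nu>) + (\<integral>x. field_normsq M (snd w) x \<partial>\<nu>))"

definition lin_comb :: "real \<Rightarrow> ('m \<Rightarrow> real) \<times> ('m, 'n::finite) field
    \<Rightarrow> real \<Rightarrow> ('m \<Rightarrow> real) \<times> ('m, 'n) field \<Rightarrow> ('m \<Rightarrow> real) \<times> ('m, 'n) field" where
  "lin_comb a w b w' =
     ((\<lambda>x. a * fst w x + b * fst w' x), (\<lambda>c p. a *\<^sub>R snd w c p + b *\<^sub>R snd w' c p))"

text \<open>Bounded and compact linear operators from \<open>W12 M \<nu>\<close> to \<open>L\<^sup>p(\<rho>)\<close>.\<close>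

definition W12_linear :: "('m::topological_space, 'n::finite) riem \<Rightarrow> 'm measure
    \<Rightarrow> real \<Rightarrow> 'm measure \<Rightarrow> (('m \<Rightarrow> real) \<times> ('m, 'n) field \<Rightarrow> 'm \<Rightarrow> real) \<Rightarrow> bool" where
  "W12_linear M \<nu> p \<rho> T \<longleftrightarrow>
     (\<forall>w\<in>W12 M \<nu>. T w \<in> Lp p \<rho>) \<and>
     (\<forall>w\<in>W12 M \<nu>. \<forall>w'\<in>W12 M \<nu>. \<forall>a b.
        AE x in \<rho>. T (lin_comb a w b w') x = a * T w x + b * T w' x)"

definition W12_bounded :: "('m::topological_space, 'n::finite) riem \<Rightarrow> 'm measure
    \<Rightarrow> real \<Rightarrow> 'm measure \<Rightarrow> (('m \<Rightarrow> real) \<times> ('m, 'n) field \<Rightarrow> 'm \<Rightarrow> real) \<Rightarrow> bool" where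
  "W12_bounded M \<nu> p \<rho> T \<longleftrightarrow>
     W12_linear M \<nu> p \<rho> T \<and>
     (\<exists>K. \<forall>w\<in>W12 M \<nu>. Lp_norm p \<rho> (T w) \<le> K * W12_norm M \<nu> w)"

definition W12_compact :: "('m::topological_space, 'n::finite) riem \<Rightarrow> 'm measure
    \<Rightarrow> real \<Rightarrow> 'm measure \<Rightarrow> (('m \<Rightarrow> real) \<times> ('m, 'n) field \<Rightarrow> 'm \<Rightarrow> real) \<Rightarrow> bool" where
  "W12_compact M \<nu> p \<rho> T \<longleftrightarrow>
     W12_linear M \<nu> p \<rho> T \<and>
     (\<forall>w :: nat \<Rightarrow> ('m \<Rightarrow> real) \<times> ('m, 'n) field.
        (\<forall>k. w k \<in> W12 M \<nu>) \<and> (\<exists>K. \<forall>k. W12_norm M \<nu> (w k) \<le> K) \<longrightarrow>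
        (\<exists>r h. strict_mono r \<and> h \<in> Lp p \<rho> \<and>
           (\<lambda>k. Lp_norm p \<rho> (\<lambda>x. T (w (r k)) x - h x)) \<longlonglongrightarrow> 0))"

text \<open>
  The embeddings are the operators \<open>(u, V) \<mapsto> u\<close>; the trace is the continuous extension of the
  restriction of \<open>C\<^sup>1\<close> functions to the boundary.
\<close>

definition compactly_embedded :: "('m::topological_space, 'n::finite) riem \<Rightarrow> 'm measure
    \<Rightarrow> real \<Rightarrow> 'm measure \<Rightarrow> bool" where
  "compactly_embedded M \<nu> p \<rho> \<longleftrightarrow> W12_compact M \<nu> p \<rho> fst"

definition continuously_embedded :: "('m::topological_space, 'n::finite) riem \<Rightarrow> 'm measure
    \<Rightarrow> real \<Rightarrow> 'm measure \<Rightarrow> bool" where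
  "continuously_embedded M \<nu> p \<rho> \<longleftrightarrow> W12_bounded M \<nu> p \<rho> fst"

definition compact_trace :: "('m::topological_space, 'n::finite) riem \<Rightarrow> 'm measure
    \<Rightarrow> real \<Rightarrow> 'm measure \<Rightarrow> bool" where
  "compact_trace M \<nu> p \<rho> \<longleftrightarrow>
     (\<exists>T. W12_compact M \<nu> p \<rho> T \<and> (\<forall>f\<in>C1 M. AE x in \<rho>. T (f, gradient M f) x = f x))"


section \<open>Variance, entropy and functional inequalities\<close>

definition Var :: "'m measure \<Rightarrow> ('m \<Rightarrow> real) \<Rightarrow> real" where
  "Var \<nu> f = (\<integral>x. (f x)\<^sup>2 \<partial>\<nu>) - (\<integral>x. f x \<partial>\<nu>)\<^sup>2"

text \<open>\<open>Ent_sq \<nu> f\<close> is the entropy of \<open>f\<^sup>2\<close>; since \<open>ln 0 = 0\<close>, the convention \<open>0 ln 0 = 0\<close> holds.\<close>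

definition Ent_sq :: "'m measure \<Rightarrow> ('m \<Rightarrow> real) \<Rightarrow> real" where
  "Ent_sq \<nu> f =
     (\<integral>x. (f x)\<^sup>2 * ln ((f x)\<^sup>2) \<partial>\<nu>) - (\<integral>x. (f x)\<^sup>2 \<partial>\<nu>) * ln (\<integral>x. (f x)\<^sup>2 \<partial>\<nu>)"

text \<open>The smallest constants in the Poincare and logarithmic Sobolev inequalities.\<close>

definition poincare_const :: "('m, 'n::finite) riem \<Rightarrow> 'm measure \<Rightarrow> ereal" where
  "poincare_const M \<nu> = Inf (ereal ` {C. \<forall>f\<in>C1 M. Var \<nu> f \<le> C * (\<integral>x. grad_sq M f x \<partial>\<nu>)})"

definition log_sobolev_const :: "('m, 'n::finite) riem \<Rightarrow> 'm measure \<Rightarrow> ereal" where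
  "log_sobolev_const M \<nu> = Inf (ereal ` {C. \<forall>f\<in>C1 M. Ent_sq \<nu> f \<le> C * (\<integral>x. grad_sq M f x \<partial>\<nu>)})"

text \<open>The measure \<open>\<alpha> d\<Lambda> + \<beta> d\<sigma>\<close> on \<open>M\<close>, where \<open>\<Lambda>\<close> lives on \<open>M\<close> and \<open>\<sigma>\<close> on its boundary.\<close>

definition bulk_boundary_measure :: "('m::topological_space, 'n::finite) riem
    \<Rightarrow> 'm measure \<Rightarrow> ('m \<Rightarrow> real) \<Rightarrow> 'm measure \<Rightarrow> ('m \<Rightarrow> real) \<Rightarrow> 'm measure" where
  "bulk_boundary_measure M \<Lambda> \<alpha> \<sigma> \<beta> =
     measure_of (points M) (sets (restrict_space borel (points M)))
       (\<lambda>E. emeasure (weighted \<Lambda> \<alpha>) E + emeasure (weighted \<sigma> \<beta>) (E \<inter> boundary_points M))"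

end

theory Submission
  imports Defs
begin

text \<open>
  Let \<open>g = f - m\<close>, where \<open>m\<close> is the mean of \<open>f\<close> for the normalized bulk measure. Since the variance
  is the least second moment about a point, \<open>Var \<mu> f \<le> \<integral>g\<^sup>2 d\<mu>\<close>, and the right-hand side splits into
  a bulk part \<open>\<integral>g\<^sup>2 \<alpha> d\<Lambda>\<close> and a boundary part \<open>\<integral>g\<^sup>2 \<beta> d\<sigma>\<close> (\<open>integral_bulk_boundary\<close>). The Poincare
  inequality in the bulk bounds the first part by a multiple of the energy
  \<open>\<integral>\<bar>\<nabla>g\<bar>\<^sup>2 \<alpha> d\<Lambda> = \<integral>\<bar>\<nabla>f\<bar>\<^sup>2 \<alpha> d\<Lambda>\<close>. The trace operator is compact, hence bounded
  (\<open>compact_trace_bounded\<close>), so the boundary part is at most a multiple of the squared Sobolev norm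
  of \<open>g\<close>; that norm is the sum of the bulk part and the energy, both already controlled.

  To use the trace operator one has to know that a C1 function together with its gradient is an
  element of the Sobolev space (\<open>C1_in_W12\<close>). As the gradient is given chart by chart, this means
  that it is a tangent field, which follows from the chain rule and the invariance of the metric,
  and that its length is continuous, hence bounded on the compact manifold. Continuity comes from
  Cramer's rule, which expresses the gradient rationally in the metric and the partial
  derivatives of the function.
\<close>

section \<open>Linear algebra of positive definite forms\<close>

lemma bilinear_linear_left: "bilinear b \<Longrightarrow> linear (\<lambda>v. b v w)"
  by (simp add: bilinear_def)

lemma bilinear_linear_right: "bilinear b \<Longrightarrow> linear (b v)"
  by (auto simp: bilinear_def)

lemma linear_vec_expansion:
  fixes l :: "real^'n::finite \<Rightarrow> real"
  assumes "linear l"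
  shows "l v = (\<Sum>i\<in>UNIV. v $ i * l (axis i 1))"
proof -
  have "l v = l (\<Sum>i\<in>UNIV. v $ i *\<^sub>R axis i 1)"
    using basis_expansion[of v] by (simp add: scalar_mult_eq_scaleR)
  also have "\<dots> = (\<Sum>i\<in>UNIV. v $ i * l (axis i 1))"
    by (simp add: linear_sum[OF assms] linear_scale[OF assms])
  finally show ?thesis .
qed

definition gram_matrix :: "(real^'n \<Rightarrow> real^'n \<Rightarrow> real) \<Rightarrow> real^'n^'n::finite" where
  "gram_matrix b = (\<chi> i j. b (axis i 1) (axis j 1))"

lemma gram_matrix_mult:
  assumes "bilinear b"
  shows "(gram_matrix b *v v) $ i = b (axis i 1) v"
  using linear_vec_expansion[OF bilinear_linear_right[OF assms], of "axis i 1" v]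
  by (simp add: gram_matrix_def matrix_vector_mult_def mult.commute)

lemma det_gram_matrix_nonzero:
  assumes "bilinear b" and pos: "\<And>v. v \<noteq> 0 \<Longrightarrow> 0 < b v v"
  shows "det (gram_matrix b) \<noteq> 0"
proof -
  have "v = 0" if "gram_matrix b *v v = 0" for v
  proof (rule ccontr)
    assume "v \<noteq> 0"
    have "b (axis i 1) v = 0" for i
      using gram_matrix_mult[OF assms(1), of v i] that by simp
    then have "b v v = 0"
      by (subst linear_vec_expansion[OF bilinear_linear_left[OF assms(1)]]) simp
    with pos[OF \<open>v \<noteq> 0\<close>] show False by simp
  qed
  then show ?thesis
    by (metis invertible_det_nz invertible_left_inverse matrix_left_invertible_ker)
qed

text \<open>
  The vector representing a linear form \<open>l\<close> with respect to an inner product \<open>b\<close> is written by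
  Cramer's rule: this makes it a rational function of the coefficients of \<open>b\<close> and \<open>l\<close>, so that it
  inherits their continuity.
\<close>

definition riesz_vector :: "(real^'n \<Rightarrow> real^'n \<Rightarrow> real) \<Rightarrow> (real^'n \<Rightarrow> real) \<Rightarrow> real^'n::finite" where
  "riesz_vector b l =
     (\<chi> k. det (\<chi> i j. if j = k then l (axis i 1) else b (axis i 1) (axis j 1)) / det (gram_matrix b))"

lemma riesz_vector_represents:
  assumes b: "bilinear b" "\<And>v w. b v w = b w v" "\<And>v. v \<noteq> 0 \<Longrightarrow> 0 < b v v" and l: "linear l"
  shows "b (riesz_vector b l) w = l w"
proof -
  have "gram_matrix b *v riesz_vector b l = (\<chi> i. l (axis i 1))"
    by (rule iffD2[OF cramer[OF det_gram_matrix_nonzero[OF b(1,3)]]])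
       (simp_all add: riesz_vector_def gram_matrix_def cong: if_cong)
  then have "b (axis i 1) (riesz_vector b l) = l (axis i 1)" for i
    by (metis gram_matrix_mult[OF b(1)] vec_lambda_beta)
  then have "b w (riesz_vector b l) = l w"
    by (simp add: linear_vec_expansion[OF bilinear_linear_left[OF b(1)], of w]
        linear_vec_expansion[OF l, of w])
  with b(2) show ?thesis by metis
qed

lemma represented_form_unique:
  fixes b :: "'a::real_vector \<Rightarrow> 'a \<Rightarrow> real"
  assumes b: "bilinear b" "\<And>v. v \<noteq> 0 \<Longrightarrow> 0 < b v v"
    and eq: "\<And>w. b u w = b v w"
  shows "u = v"
proof -
  have "b (u - v) (u - v) = 0"
    using eq by (simp add: bilinear_lsub[OF b(1)])
  then have "u - v = 0"
    using b(2)[of "u - v"] by fastforce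
  then show ?thesis by simp
qed

lemma continuous_on_det:
  fixes m :: "'i::finite \<Rightarrow> 'i \<Rightarrow> 'a::topological_space \<Rightarrow> real"
  assumes "\<And>i j. continuous_on S (m i j)"
  shows "continuous_on S (\<lambda>x. det (\<chi> i j. m i j x))"
  unfolding det_def using assms by (auto intro!: continuous_intros)

lemma continuous_on_riesz_vector:
  fixes b :: "'a::topological_space \<Rightarrow> real^'n::finite \<Rightarrow> real^'n \<Rightarrow> real"
  assumes b: "\<And>x. x \<in> S \<Longrightarrow> bilinear (b x)" "\<And>x v. x \<in> S \<Longrightarrow> v \<noteq> 0 \<Longrightarrow> 0 < b x v v"
    and cont: "\<And>v w. continuous_on S (\<lambda>x. b x v w)" "\<And>v. continuous_on S (\<lambda>x. l x v)"
  shows "continuous_on S (\<lambda>x. riesz_vector (b x) (l x))"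
proof -
  have "continuous_on S (\<lambda>x. if j = k then l x (axis i 1) else b x (axis i 1) (axis j 1))"
    for i j k :: 'n
    using cont by (cases "j = k") simp_all
  then show ?thesis
    unfolding riesz_vector_def
    using cont det_gram_matrix_nonzero[OF b]
    by (intro continuous_on_vec_lambda continuous_on_divide continuous_on_det)
       (auto simp: gram_matrix_def intro!: continuous_on_det)
qed


section \<open>Charts and differentials\<close>

text \<open>
  From every point of the half-space one can move a little in each positive coordinate direction,
  which is enough to determine a derivative taken within a relatively open subset.
\<close>

lemma half_space_derivative_unique:
  fixes S :: "(real^'n::finite) set" and f :: "real^'n \<Rightarrow> 'b::real_normed_vector"
  assumes S: "openin (top_of_set half_space) S" "x \<in> S"
    and "(f has_derivative F) (at x within S)" "(f has_derivative G) (at x within S)"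
  shows "F = G"
proof (rule frechet_derivative_unique_within[OF assms(3,4)])
  fix i :: "real^'n" and e :: real
  assume i: "i \<in> Basis" and "0 < e"
  obtain \<delta> where \<delta>: "0 < \<delta>" "ball x \<delta> \<inter> half_space \<subseteq> S"
    using S by (auto simp: openin_contains_ball)
  define d where "d = min e \<delta> / 2"
  have d: "0 < d" "d < e" "d < \<delta>"
    using \<open>0 < e\<close> \<delta>(1) by (auto simp: d_def)
  have "x \<in> half_space"
    using S by (auto dest: openin_imp_subset)
  moreover have "0 \<le> i $ normal_index"
    using i by (auto simp: Basis_vec_def axis_def)
  ultimately have "x + d *\<^sub>R i \<in> half_space"
    using d(1) by (simp add: half_space_def)
  moreover have "x + d *\<^sub>R i \<in> ball x \<delta>"
    using d i by (simp add: dist_norm)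
  ultimately show "\<exists>d. 0 < \<bar>d\<bar> \<and> \<bar>d\<bar> < e \<and> x + d *\<^sub>R i \<in> S"
    using d \<delta>(2) by (intro exI[of _ d]) auto
qed

lemma half_space_frechet_derivative:
  fixes S :: "(real^'n::finite) set"
  assumes "openin (top_of_set half_space) S" "x \<in> S" "(f has_derivative F) (at x within S)"
  shows "frechet_derivative f (at x within S) = F"
  using assms half_space_derivative_unique frechet_derivative_works differentiable_def by metis

definition chart_differential :: "('m, 'n::finite) riem \<Rightarrow> ('m \<Rightarrow> real) \<Rightarrow> ('m, 'n) chart \<Rightarrow> 'm
    \<Rightarrow> real^'n \<Rightarrow> real" where
  "chart_differential M f c p =
     frechet_derivative (f \<circ> chart_inv c) (at (snd c p) within chart_image M c)"

lemma continuous_on_open_cover: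
  assumes cover: "\<And>x. x \<in> X \<Longrightarrow> \<exists>U. openin (top_of_set X) U \<and> x \<in> U \<and> continuous_on U f"
  shows "continuous_on X f"
  unfolding continuous_on_def
proof
  fix x assume "x \<in> X"
  then obtain U where U: "openin (top_of_set X) U" "x \<in> U" "continuous_on U f"
    using cover by blast
  then obtain T where T: "open T" "U = X \<inter> T"
    by (auto simp: openin_open)
  have "at x within U = at x within X"
    using T U(2) by (intro at_within_nhd[of x T]) auto
  with U(2,3) show "(f \<longlongrightarrow> f x) (at x within X)"
    unfolding continuous_on_def by metis
qed

context
  fixes M :: "('m::topological_space, 'n::finite) riem"
  assumes M: "riemannian_manifold M"
begin

lemma charts_cover: "(\<Union>c\<in>charts M. fst c) = points M"
  using M by (simp add: riemannian_manifold_def smooth_atlas_def)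

lemma tangent_vectors_UNIV: "tangent_vectors M = UNIV"
  using M by (simp add: riemannian_manifold_def tangent_vectors_def)

lemma chart_homeomorphism:
  "c \<in> charts M \<Longrightarrow> homeomorphism (fst c) (snd c ` fst c) (snd c) (chart_inv c)"
  using M by (simp add: riemannian_manifold_def smooth_atlas_def is_chart_def)

lemma chart_domain_open: "c \<in> charts M \<Longrightarrow> openin (top_of_set (points M)) (fst c)"
  using M by (simp add: riemannian_manifold_def smooth_atlas_def is_chart_def)

lemma chart_domain_Int_points: "c \<in> charts M \<Longrightarrow> fst c \<inter> points M = fst c"
  using charts_cover by blast

lemma chart_image_eq: "c \<in> charts M \<Longrightarrow> chart_image M c = snd c ` fst c"
  by (simp add: chart_image_def chart_domain_Int_points)

lemma chart_inv_chart: "c \<in> charts M \<Longrightarrow> p \<in> fst c \<Longrightarrow> chart_inv c (snd c p) = p"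
  using chart_homeomorphism homeomorphism_apply1 by metis

lemma continuous_on_chart: "c \<in> charts M \<Longrightarrow> continuous_on (fst c) (snd c)"
  using chart_homeomorphism homeomorphism_cont1 by metis

lemma open_chart_image: "c \<in> charts M \<Longrightarrow> openin (top_of_set half_space) (snd c ` fst c)"
  using M by (simp add: riemannian_manifold_def smooth_atlas_def is_chart_def)

lemma open_chart_image_overlap:
  assumes "c \<in> charts M" "c' \<in> charts M"
  shows "openin (top_of_set half_space) (snd c ` (fst c \<inter> fst c'))"
proof -
  have "openin (top_of_set (fst c)) (fst c \<inter> fst c')"
    using chart_domain_open assms charts_cover
    by (metis UN_upper inf_le1 openin_Int openin_subset_trans)
  from homeomorphism_imp_open_map[OF chart_homeomorphism[OF assms(1)] this]
  show ?thesis
    using open_chart_image[OF assms(1)] openin_trans by blast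
qed

lemma metric_at:
  assumes "c \<in> charts M" "p \<in> fst c"
  shows "bilinear (metric M c p)" "metric M c p v w = metric M c p w v"
    "v \<noteq> 0 \<Longrightarrow> 0 < metric M c p v v"
  using M assms unfolding riemannian_manifold_def by blast+

lemma metric_transition:
  assumes "c \<in> charts M" "c' \<in> charts M" "p \<in> fst c" "p \<in> fst c'"
  shows "metric M c p v w =
    metric M c' p (transition_deriv c c' p v) (transition_deriv c c' p w)"
  using M assms unfolding riemannian_manifold_def by blast

lemma continuous_on_chart_domain:
  assumes c: "c \<in> charts M" and "continuous_on (snd c ` fst c) (\<lambda>x. h (chart_inv c x))"
  shows "continuous_on (fst c) h"
proof -
  have "continuous_on (fst c) (\<lambda>p. h (chart_inv c (snd c p)))"
    using continuous_on_compose[OF continuous_on_chart[OF c]] assms(2) by (simp add: o_def)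
  then show ?thesis
    by (rule continuous_on_eq) (simp add: chart_inv_chart[OF c])
qed

lemma continuous_on_metric:
  assumes c: "c \<in> charts M"
  shows "continuous_on (fst c) (\<lambda>p. metric M c p v w)"
proof -
  have "smooth_on (snd c ` fst c) (\<lambda>x. metric M c (chart_inv c x) v w)"
    using M c by (simp add: riemannian_manifold_def)
  then have "Ck_on 0 (snd c ` fst c) (\<lambda>x. metric M c (chart_inv c x) v w)"
    unfolding smooth_on_def by (rule spec)
  then show ?thesis
    using continuous_on_chart_domain[OF c, of "\<lambda>p. metric M c p v w"] by simp
qed

lemma continuous_on_manifold:
  assumes "\<And>c. c \<in> charts M \<Longrightarrow> continuous_on (fst c) h"
  shows "continuous_on (points M) h"
proof (rule continuous_on_open_cover)
  fix p assume "p \<in> points M"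
  then obtain c where "c \<in> charts M" "p \<in> fst c"
    using charts_cover by blast
  with assms chart_domain_open
  show "\<exists>U. openin (top_of_set (points M)) U \<and> p \<in> U \<and> continuous_on U h"
    by (intro exI[of _ "fst c"]) simp
qed

lemma transition_has_derivative:
  assumes c: "c \<in> charts M" "c' \<in> charts M" and p: "p \<in> fst c" "p \<in> fst c'"
  shows "((snd c' \<circ> chart_inv c) has_derivative transition_deriv c c' p)
    (at (snd c p) within snd c ` (fst c \<inter> fst c'))"
proof -
  have "smooth_on (snd c ` (fst c \<inter> fst c')) (snd c' \<circ> chart_inv c)"
    using M c by (simp add: riemannian_manifold_def smooth_atlas_def)
  then have "Ck_on (Suc 0) (snd c ` (fst c \<inter> fst c')) (snd c' \<circ> chart_inv c)"
    unfolding smooth_on_def by (rule spec)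
  then show ?thesis
    unfolding transition_deriv_def using p
    by (auto simp: frechet_derivative_works[symmetric] differentiable_def)
qed

text \<open>A change of coordinates preserves the metric, so its differential cannot have a kernel.\<close>

lemma surj_transition_deriv:
  assumes c: "c \<in> charts M" "c' \<in> charts M" and p: "p \<in> fst c" "p \<in> fst c'"
  shows "surj (transition_deriv c c' p)"
proof -
  have lin: "linear (transition_deriv c c' p)"
    using transition_has_derivative[OF assms] has_derivative_linear by blast
  have "v = 0" if "transition_deriv c c' p v = 0" for v
    using metric_transition[OF assms, of v v] that metric_at(3)[OF c(1) p(1), of v]
      bilinear_lzero[OF metric_at(1)[OF c(2) p(2)]] by fastforce
  then have "inj (transition_deriv c c' p)"
    using lin linear_injective_0 by blast
  then show ?thesis
    using lin linear_injective_imp_surjective by blast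
qed

lemma C1_continuous_differential:
  assumes f: "f \<in> C1 M" and c: "c \<in> charts M"
  shows "\<And>p. p \<in> fst c \<Longrightarrow> ((f \<circ> chart_inv c) has_derivative chart_differential M f c p)
      (at (snd c p) within snd c ` fst c)"
    and "\<And>v. continuous_on (fst c) (\<lambda>p. chart_differential M f c p v)"
proof -
  have "Ck_on (Suc 0) (snd c ` fst c) (f \<circ> chart_inv c)"
    using f c unfolding C1_def by (metis (mono_tags, lifting) One_nat_def chart_image_eq mem_Collect_eq)
  then obtain f' where f': "\<And>x. x \<in> snd c ` fst c \<Longrightarrow>
      ((f \<circ> chart_inv c) has_derivative f' x) (at x within snd c ` fst c)"
    "\<And>v. continuous_on (snd c ` fst c) (\<lambda>x. f' x v)"
    by auto
  have eq: "chart_differential M f c p = f' (snd c p)" if "p \<in> fst c" for p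
    unfolding chart_differential_def chart_image_eq[OF c]
    using half_space_frechet_derivative[OF open_chart_image[OF c]] f'(1) that by blast
  show "((f \<circ> chart_inv c) has_derivative chart_differential M f c p)
      (at (snd c p) within snd c ` fst c)" if "p \<in> fst c" for p
    using f'(1) eq that by simp
  show "continuous_on (fst c) (\<lambda>p. chart_differential M f c p v)" for v
  proof -
    have "continuous_on (fst c) (\<lambda>p. f' (snd c p) v)"
      using continuous_on_compose[OF continuous_on_chart[OF c] f'(2)] by (simp add: o_def)
    then show ?thesis
      by (rule continuous_on_eq) (simp add: eq)
  qed
qed

lemma linear_chart_differential:
  "f \<in> C1 M \<Longrightarrow> c \<in> charts M \<Longrightarrow> p \<in> fst c \<Longrightarrow> linear (chart_differential M f c p)"
  using C1_continuous_differential(1) has_derivative_linear by blast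

lemma C1_continuous_on:
  assumes f: "f \<in> C1 M"
  shows "continuous_on (points M) f"
proof (rule continuous_on_manifold)
  fix c assume c: "c \<in> charts M"
  have "continuous_on (snd c ` fst c) (f \<circ> chart_inv c)"
    using has_derivative_continuous[OF C1_continuous_differential(1)[OF f c]]
    unfolding continuous_on_eq_continuous_within by blast
  then show "continuous_on (fst c) f"
    by (intro continuous_on_chart_domain[OF c]) (simp add: o_def)
qed

text \<open>
  The chain rule holds within the image of the overlap of the charts, which is relatively open in
  the half-space, and there a one-sided derivative is unique.
\<close>

lemma chart_differential_transition:
  assumes f: "f \<in> C1 M" and c: "c \<in> charts M" "c' \<in> charts M" and p: "p \<in> fst c" "p \<in> fst c'"
  shows "chart_differential M f c p v = chart_differential M f c' p (transition_deriv c c' p v)"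
proof -
  let ?S = "snd c ` (fst c \<inter> fst c')"
  let ?\<tau> = "snd c' \<circ> chart_inv c"
  have \<tau>: "?\<tau> (snd c p) = snd c' p" "?\<tau> ` ?S \<subseteq> snd c' ` fst c'"
    using p by (auto simp: chart_inv_chart[OF c(1)])
  have "((f \<circ> chart_inv c') \<circ> ?\<tau> has_derivative
      chart_differential M f c' p \<circ> transition_deriv c c' p) (at (snd c p) within ?S)"
  proof (rule diff_chain_within)
    show "(?\<tau> has_derivative transition_deriv c c' p) (at (snd c p) within ?S)"
      by (rule transition_has_derivative[OF c p])
    show "(f \<circ> chart_inv c' has_derivative chart_differential M f c' p)
        (at (?\<tau> (snd c p)) within ?\<tau> ` ?S)"
      unfolding \<tau>(1)
      using C1_continuous_differential(1)[OF f c(2) p(2)] \<tau>(2) has_derivative_subset by blast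
  qed
  then have "(f \<circ> chart_inv c has_derivative
      chart_differential M f c' p \<circ> transition_deriv c c' p) (at (snd c p) within ?S)"
    by (rule has_derivative_transform[rotated 2])
       (use p in \<open>auto simp: chart_inv_chart[OF c(1)] chart_inv_chart[OF c(2)]\<close>)
  moreover have "(f \<circ> chart_inv c has_derivative chart_differential M f c p)
      (at (snd c p) within ?S)"
    using C1_continuous_differential(1)[OF f c(1) p(1)] has_derivative_subset
    by (metis image_mono inf_le1)
  moreover have "snd c p \<in> ?S"
    using p by simp
  ultimately have "chart_differential M f c p =
      chart_differential M f c' p \<circ> transition_deriv c c' p"
    using half_space_derivative_unique[OF open_chart_image_overlap[OF c]] by blast
  then show ?thesis by simp
qed

section \<open>The gradient of a C1 function\<close>

lemma gradient_eq_iff: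
  assumes f: "f \<in> C1 M" and c: "c \<in> charts M" and p: "p \<in> fst c"
  shows "gradient M f c p = v \<longleftrightarrow> (\<forall>w. metric M c p v w = chart_differential M f c p w)"
proof -
  note m = metric_at[OF c p]
  have ex: "\<forall>w. metric M c p (riesz_vector (metric M c p) (chart_differential M f c p)) w =
      chart_differential M f c p w"
    using riesz_vector_represents[OF m linear_chart_differential[OF f c p]] by simp
  have uniq: "u = v" if "\<forall>w. metric M c p u w = chart_differential M f c p w"
    "\<forall>w. metric M c p v w = chart_differential M f c p w" for u v
    using represented_form_unique[OF m(1,3)] that by simp
  have the: "gradient M f c p = (THE v. \<forall>w. metric M c p v w = chart_differential M f c p w)"
    unfolding gradient_def tangent_vectors_UNIV chart_differential_def by simp
  have grad: "\<forall>w. metric M c p (gradient M f c p) w = chart_differential M f c p w"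
    unfolding the
    by (rule theI[where P = "\<lambda>v. \<forall>w. metric M c p v w = chart_differential M f c p w", OF ex])
       (rule uniq[OF _ ex])
  show ?thesis
    using grad uniq[OF grad] by blast
qed

lemma metric_gradient:
  assumes "f \<in> C1 M" "c \<in> charts M" "p \<in> fst c"
  shows "metric M c p (gradient M f c p) w = chart_differential M f c p w"
  using iffD1[OF gradient_eq_iff[OF assms] refl] by (rule spec)

lemma continuous_on_gradient:
  assumes f: "f \<in> C1 M" and c: "c \<in> charts M"
  shows "continuous_on (fst c) (gradient M f c)"
proof -
  have "continuous_on (fst c) (\<lambda>p. riesz_vector (metric M c p) (chart_differential M f c p))"
    using metric_at[OF c] continuous_on_metric[OF c] C1_continuous_differential(2)[OF f c]
    by (intro continuous_on_riesz_vector) auto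
  then show ?thesis
  proof (rule continuous_on_eq)
    fix p assume p: "p \<in> fst c"
    show "riesz_vector (metric M c p) (chart_differential M f c p) = gradient M f c p"
      using gradient_eq_iff[OF f c p]
        riesz_vector_represents[OF metric_at[OF c p] linear_chart_differential[OF f c p]]
      by metis
  qed
qed

text \<open>
  Seen through \<open>c'\<close>, the transported vector represents the differential of \<open>f\<close> when tested against
  transported vectors; since these exhaust the tangent space, it is the gradient in \<open>c'\<close>.
\<close>

lemma tangent_field_gradient:
  assumes f: "f \<in> C1 M"
  shows "tangent_field M (gradient M f)"
  unfolding tangent_field_def tangent_vectors_UNIV
proof (intro ballI conjI impI)
  fix c c' p
  assume c: "c \<in> charts M" "c' \<in> charts M" and "p \<in> fst c \<inter> points M" and p': "p \<in> fst c'"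
  then have p: "p \<in> fst c" by simp
  let ?D = "transition_deriv c c' p"
  have "metric M c' p (?D (gradient M f c p)) w = chart_differential M f c' p w" for w
  proof -
    obtain v where v: "w = ?D v"
      using surj_transition_deriv[OF c p p'] by blast
    show ?thesis
      using metric_gradient[OF f c(1) p, of v]
      unfolding v metric_transition[OF c p p', symmetric]
        chart_differential_transition[OF f c p p', symmetric] .
  qed
  then show "gradient M f c' p = ?D (gradient M f c p)"
    using gradient_eq_iff[OF f c(2) p'] by blast
qed simp

text \<open>
  The chart in the definition of \<open>field_normsq\<close> is selected point by point; for a tangent field it
  may be replaced by one chart on its whole domain, which makes continuity accessible.
\<close>

lemma field_normsq_chart:
  assumes V: "tangent_field M V" and c: "c \<in> charts M" and p: "p \<in> fst c"
  shows "field_normsq M V p = metric M c p (V c p) (V c p)"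
proof -
  define c' where "c' = (SOME c. c \<in> charts M \<and> p \<in> fst c)"
  have c': "c' \<in> charts M" "p \<in> fst c'"
    using someI[of "\<lambda>c. c \<in> charts M \<and> p \<in> fst c" c] c p by (auto simp: c'_def)
  have "V c' p = transition_deriv c c' p (V c p)"
    using V c c' p chart_domain_Int_points[OF c] unfolding tangent_field_def by blast
  then show ?thesis
    using metric_transition[OF c c'(1) p c'(2), of "V c p" "V c p"]
    unfolding field_normsq_def c'_def[symmetric] Let_def by simp
qed

lemma field_normsq_zero:
  assumes p: "p \<in> points M"
  shows "field_normsq M (\<lambda>c p. 0) p = 0"
proof -
  obtain c where "c \<in> charts M \<and> p \<in> fst c"
    using p charts_cover by blast
  from someI[of "\<lambda>c. c \<in> charts M \<and> p \<in> fst c", OF this]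
  show ?thesis
    using bilinear_lzero[OF metric_at(1)] by (simp add: field_normsq_def Let_def)
qed

lemma grad_sq_nonneg:
  assumes f: "f \<in> C1 M" and p: "p \<in> points M"
  shows "0 \<le> grad_sq M f p"
proof -
  obtain c where c: "c \<in> charts M" "p \<in> fst c"
    using p charts_cover by blast
  show ?thesis
    unfolding field_normsq_chart[OF tangent_field_gradient[OF f] c]
    using metric_at(3)[OF c, of "gradient M f c p"] bilinear_lzero[OF metric_at(1)[OF c], of 0]
    by (cases "gradient M f c p = 0") auto
qed

text \<open>In a chart, \<open>\<bar>\<nabla>f\<bar>\<^sup>2\<close> is the differential of \<open>f\<close> evaluated at the gradient.\<close>

lemma continuous_on_grad_sq:
  assumes f: "f \<in> C1 M"
  shows "continuous_on (points M) (grad_sq M f)"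
proof (rule continuous_on_manifold)
  fix c assume c: "c \<in> charts M"
  have "continuous_on (fst c)
      (\<lambda>p. \<Sum>i\<in>UNIV. gradient M f c p $ i * chart_differential M f c p (axis i 1))"
    using continuous_on_gradient[OF f c] C1_continuous_differential(2)[OF f c]
    by (intro continuous_intros)
  then show "continuous_on (fst c) (grad_sq M f)"
  proof (rule continuous_on_eq)
    fix p assume p: "p \<in> fst c"
    show "(\<Sum>i\<in>UNIV. gradient M f c p $ i * chart_differential M f c p (axis i 1)) = grad_sq M f p"
      unfolding field_normsq_chart[OF tangent_field_gradient[OF f] c p] metric_gradient[OF f c p]
      using linear_vec_expansion[OF linear_chart_differential[OF f c p]] by metis
  qed
qed

lemma C1_affine:
  assumes f: "f \<in> C1 M"
  shows "(\<lambda>p. a * f p + b) \<in> C1 M"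
  unfolding C1_def
proof (intro CollectI ballI)
  fix c assume c: "c \<in> charts M"
  have "Ck_on (Suc 0) (chart_image M c) (f \<circ> chart_inv c)"
    using f c by (simp add: C1_def)
  then obtain f' where "\<forall>x\<in>chart_image M c.
      ((f \<circ> chart_inv c) has_derivative f' x) (at x within chart_image M c)"
    "\<forall>v. continuous_on (chart_image M c) (\<lambda>x. f' x v)"
    by auto
  then have "(\<forall>x\<in>chart_image M c. ((\<lambda>x. a * (f \<circ> chart_inv c) x + b) has_derivative
      (\<lambda>v. a * f' x v)) (at x within chart_image M c)) \<and>
      (\<forall>v. continuous_on (chart_image M c) (\<lambda>x. a * f' x v))"
    by (intro conjI ballI allI has_derivative_add_const has_derivative_mult_right
        continuous_on_mult_left) (auto simp: o_def)
  then show "Ck_on 1 (chart_image M c) ((\<lambda>p. a * f p + b) \<circ> chart_inv c)"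
    by (auto simp: o_def intro!: exI[of _ "\<lambda>x v. a * f' x v"])
qed

lemma grad_sq_affine:
  assumes f: "f \<in> C1 M" and p: "p \<in> points M"
  shows "grad_sq M (\<lambda>p. a * f p + b) p = a\<^sup>2 * grad_sq M f p"
proof -
  let ?g = "\<lambda>p. a * f p + b"
  obtain c where c: "c \<in> charts M" "p \<in> fst c"
    using p charts_cover by blast
  note g = C1_affine[OF f, of a b]
  have "((\<lambda>x. a * (f \<circ> chart_inv c) x + b) has_derivative (\<lambda>v. a * chart_differential M f c p v))
      (at (snd c p) within snd c ` fst c)"
    by (intro has_derivative_add_const has_derivative_mult_right C1_continuous_differential(1)[OF f c])
  then have "(?g \<circ> chart_inv c has_derivative (\<lambda>v. a * chart_differential M f c p v))
      (at (snd c p) within snd c ` fst c)"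
    by (simp add: o_def)
  from half_space_derivative_unique[OF open_chart_image[OF c(1)] _
      C1_continuous_differential(1)[OF g c] this]
  have "chart_differential M ?g c p = (\<lambda>v. a * chart_differential M f c p v)"
    using c by simp
  then have "gradient M ?g c p = a *\<^sub>R gradient M f c p"
    unfolding gradient_eq_iff[OF g c]
    using bilinear_lmul[OF metric_at(1)[OF c]] metric_gradient[OF f c] by simp
  then show ?thesis
    unfolding field_normsq_chart[OF tangent_field_gradient[OF f] c]
      field_normsq_chart[OF tangent_field_gradient[OF g] c]
    using bilinear_lmul[OF metric_at(1)[OF c]] bilinear_rmul[OF metric_at(1)[OF c]]
    by (simp add: power2_eq_square mult.assoc)
qed

end


section \<open>Integrals of continuous functions\<close>

lemma integrable_continuous_on_compact:
  fixes h :: "'m::topological_space \<Rightarrow> real"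
  assumes \<nu>: "finite_measure \<nu>" "sets \<nu> = sets (restrict_space borel Y)"
    and X: "compact X" "Y \<subseteq> X" "continuous_on X h"
  shows "integrable \<nu> h"
proof -
  obtain B where B: "\<And>x. x \<in> X \<Longrightarrow> \<bar>h x\<bar> \<le> B"
    using compact_imp_bounded[OF compact_continuous_image[OF X(3,1)]]
    by (auto simp: bounded_iff)
  have "space \<nu> = Y"
    using sets_eq_imp_space_eq[OF \<nu>(2)] by (simp add: space_restrict_space)
  then have "AE x in \<nu>. norm (h x) \<le> B"
    using B X(2) by auto
  moreover have "h \<in> borel_measurable \<nu>"
    using borel_measurable_continuous_on_restrict[OF continuous_on_subset[OF X(3,2)]]
    by (simp add: measurable_cong_sets[OF \<nu>(2) refl])
  ultimately show ?thesis
    by (rule finite_measure.integrable_const_bound[OF \<nu>(1)])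
qed

lemma sets_weighted [simp]: "sets (weighted \<nu> w) = sets \<nu>"
  by (simp add: weighted_def)

lemma finite_measure_weighted:
  assumes "integrable \<nu> w"
  shows "finite_measure (weighted \<nu> w)"
proof
  have "(\<integral>\<^sup>+x. ennreal (w x) \<partial>\<nu>) \<le> (\<integral>\<^sup>+x. ennreal (norm (w x)) \<partial>\<nu>)"
    by (intro nn_integral_mono ennreal_leI) auto
  then have "(\<integral>\<^sup>+x. ennreal (w x) \<partial>\<nu>) < \<infinity>"
    using assms by (auto simp: integrable_iff_bounded intro: le_less_trans)
  moreover have "emeasure (weighted \<nu> w) (space (weighted \<nu> w)) = (\<integral>\<^sup>+x. ennreal (w x) \<partial>\<nu>)"
    using assms unfolding weighted_def
    by (subst emeasure_density) (auto intro!: nn_integral_cong simp: indicator_def)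
  ultimately show "emeasure (weighted \<nu> w) (space (weighted \<nu> w)) \<noteq> \<infinity>"
    by simp
qed

lemma integral_weighted:
  assumes "h \<in> borel_measurable \<nu>" "w \<in> borel_measurable \<nu>" "AE x in \<nu>. 0 \<le> w x"
  shows "(\<integral>x. h x \<partial>weighted \<nu> w) = (\<integral>x. h x * w x \<partial>\<nu>)"
  using integral_density[OF assms] by (simp add: weighted_def mult.commute)

lemma nn_integral_sum_measure:
  fixes u :: "'a \<Rightarrow> ennreal"
  assumes sets: "sets \<mu> = sets N" "sets N' = sets N"
    and sum: "\<And>E. E \<in> sets N \<Longrightarrow> emeasure \<mu> E = emeasure N E + emeasure N' E"
    and u: "u \<in> borel_measurable N"
  shows "(\<integral>\<^sup>+x. u x \<partial>\<mu>) = (\<integral>\<^sup>+x. u x \<partial>N) + (\<integral>\<^sup>+x. u x \<partial>N')"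
proof -
  have meas: "borel_measurable \<mu> = (borel_measurable N :: ('a \<Rightarrow> ennreal) set)"
    "borel_measurable N' = (borel_measurable N :: ('a \<Rightarrow> ennreal) set)"
    using measurable_cong_sets[OF sets(1) refl] measurable_cong_sets[OF sets(2) refl] by blast+
  have space: "space \<mu> = space N" "space N' = space N"
    using sets_eq_imp_space_eq sets by blast+
  from u show ?thesis
  proof (induction rule: borel_measurable_induct)
    case (cong f g)
    have "(\<integral>\<^sup>+x. f x \<partial>K) = (\<integral>\<^sup>+x. g x \<partial>K)" if "space K = space N" for K
      using cong(3) that by (intro nn_integral_cong) simp
    then show ?case
      using cong.IH space by simp
  next
    case (set E)
    then show ?case
      using sets sum by simp
  next
    case (mult u c)
    then show ?case
      using meas by (simp add: nn_integral_cmult distrib_left)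
  next
    case (add u v)
    then show ?case
      using meas by (simp add: nn_integral_add ac_simps)
  next
    case (seq U)
    then have mU: "U i \<in> borel_measurable N" for i by simp
    have inc: "incseq (\<lambda>i. \<integral>\<^sup>+x. U i x \<partial>K)" for K
      using \<open>incseq U\<close> by (auto simp: incseq_def le_fun_def intro!: nn_integral_mono)
    have sup: "(\<integral>\<^sup>+x. (SUP i. U i) x \<partial>K) = (SUP i. \<integral>\<^sup>+x. U i x \<partial>K)"
      if "borel_measurable K = (borel_measurable N :: ('a \<Rightarrow> ennreal) set)" for K
      unfolding SUP_apply
      by (rule nn_integral_monotone_convergence_SUP[OF \<open>incseq U\<close>]) (use mU that in blast)
    show ?case
      using seq ennreal_SUP_add[OF inc[of N] inc[of N']] sup[OF refl] sup[OF meas(1)] sup[OF meas(2)]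
      by simp
  qed
qed

text \<open>
  Extending the boundary measure by zero to the whole manifold turns \<open>bulk_boundary_measure\<close> into
  a sum of two measures on the same space.
\<close>

lemma integral_bulk_boundary:
  fixes M :: "('m::topological_space, 'n::finite) riem" and h :: "'m \<Rightarrow> real"
  assumes \<Lambda>: "sets \<Lambda> = sets (restrict_space borel (points M))" "finite_measure (weighted \<Lambda> \<alpha>)"
    and \<sigma>: "sets \<sigma> = sets (restrict_space borel (boundary_points M))" "finite_measure (weighted \<sigma> \<beta>)"
    and bdry: "boundary_points M \<subseteq> points M"
    and fin: "finite_measure (bulk_boundary_measure M \<Lambda> \<alpha> \<sigma> \<beta>)"
    and h: "compact (points M)" "continuous_on (points M) h" "\<And>x. x \<in> points M \<Longrightarrow> 0 \<le> h x"
  shows "(\<integral>x. h x \<partial>bulk_boundary_measure M \<Lambda> \<alpha> \<sigma> \<beta>) =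
    (\<integral>x. h x \<partial>weighted \<Lambda> \<alpha>) + (\<integral>x. h x \<partial>weighted \<sigma> \<beta>)"
proof -
  define X where "X = points M"
  define Y where "Y = boundary_points M"
  define N where "N = weighted \<Lambda> \<alpha>"
  define S where "S = weighted \<sigma> \<beta>"
  define \<mu> where "\<mu> = bulk_boundary_measure M \<Lambda> \<alpha> \<sigma> \<beta>"
  let ?B = "restrict_space borel X"
  note defs = X_def Y_def N_def S_def \<mu>_def
  have sets: "sets N = sets ?B" "sets S = sets (restrict_space borel Y)"
    using \<Lambda>(1) \<sigma>(1) by (simp_all add: defs)
  have space: "space N = X" "space S = Y"
    using sets_eq_imp_space_eq[OF sets(1)] sets_eq_imp_space_eq[OF sets(2)]
    by (simp_all add: space_restrict_space)
  have id: "(\<lambda>x. x) \<in> measurable S N"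
  proof (rule measurableI)
    fix x assume "x \<in> space S"
    then show "x \<in> space N" using space bdry by (auto simp: defs)
  next
    fix E assume "E \<in> sets N"
    then obtain F where F: "F \<in> sets borel" "E = X \<inter> F"
      unfolding sets sets_restrict_space by auto
    have "E \<inter> Y = Y \<inter> F"
      using F(2) bdry by (auto simp: defs)
    then show "(\<lambda>x. x) -` E \<inter> space S \<in> sets S"
      using F(1) unfolding sets space sets_restrict_space by auto
  qed
  define N' where "N' = distr S N (\<lambda>x. x)"
  have N': "sets N' = sets N" "\<And>E. E \<in> sets N \<Longrightarrow> emeasure N' E = emeasure S (E \<inter> Y)"
    by (auto simp: N'_def emeasure_distr[OF id] space)
  have \<mu>: "\<mu> = measure_of X (sets N) (\<lambda>E. emeasure N E + emeasure S (E \<inter> Y))"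
    by (simp add: defs bulk_boundary_measure_def \<Lambda>(1))
  have sets_\<mu>: "sets \<mu> = sets N"
    unfolding \<mu> using sets.sets_measure_of_eq[of N] space by simp
  have em_\<mu>: "emeasure \<mu> E = emeasure N E + emeasure N' E" if "E \<in> sets N" for E
  proof -
    have "emeasure \<mu> E = emeasure N E + emeasure S (E \<inter> Y)"
    proof (rule emeasure_measure_of[OF \<mu>])
      show "sets N \<subseteq> Pow X"
        using sets.space_closed[of N] space by simp
      show "positive (sets \<mu>) (\<lambda>E. emeasure N E + emeasure S (E \<inter> Y))"
        by (simp add: positive_def)
      show "countably_additive (sets \<mu>) (\<lambda>E. emeasure N E + emeasure S (E \<inter> Y))"
        unfolding countably_additive_def sets_\<mu>
      proof (intro allI impI)
        fix F :: "nat \<Rightarrow> 'm set"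
        assume F: "range F \<subseteq> sets N" "disjoint_family F" "(\<Union>i. F i) \<in> sets N"
        have "(\<Sum>i. emeasure N (F i) + emeasure N' (F i)) =
            emeasure N (\<Union>i. F i) + emeasure N' (\<Union>i. F i)"
          using F N'(1) by (simp add: suminf_add[symmetric] suminf_emeasure)
        then show "(\<Sum>i. emeasure N (F i) + emeasure S (F i \<inter> Y)) =
            emeasure N (\<Union>i. F i) + emeasure S ((\<Union>i. F i) \<inter> Y)"
          using F N'(2) by (simp add: range_subsetD)
      qed
      show "E \<in> sets \<mu>"
        using that sets_\<mu> by simp
    qed
    then show ?thesis
      using N'(2) that by simp
  qed
  note integrable = integrable_continuous_on_compact[OF _ _ h(1) _ h(2)]
  have int: "integrable N h" "integrable S h" "integrable \<mu> h"
    using integrable[of N X] integrable[of S Y] integrable[of \<mu> X] \<Lambda>(2) \<sigma>(2) bdry fin sets sets_\<mu>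
    by (simp_all add: defs)
  have "0 \<le> h x" if "x \<in> X" for x
    using h(3) that by (simp add: defs)
  then have nonneg: "AE x in N. 0 \<le> h x" "AE x in S. 0 \<le> h x" "AE x in \<mu>. 0 \<le> h x"
    using bdry space sets_eq_imp_space_eq[OF sets_\<mu>]
    by (auto simp flip: X_def Y_def intro!: AE_I2)
  have "(\<integral>\<^sup>+x. ennreal (h x) \<partial>\<mu>) = (\<integral>\<^sup>+x. ennreal (h x) \<partial>N) + (\<integral>\<^sup>+x. ennreal (h x) \<partial>N')"
    using int(1) by (intro nn_integral_sum_measure sets_\<mu> N'(1) em_\<mu>) auto
  also have "(\<integral>\<^sup>+x. ennreal (h x) \<partial>N') = (\<integral>\<^sup>+x. ennreal (h x) \<partial>S)"
    unfolding N'_def using int(1) by (intro nn_integral_distr id) auto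
  finally have "ennreal (\<integral>x. h x \<partial>\<mu>) = ennreal (\<integral>x. h x \<partial>N) + ennreal (\<integral>x. h x \<partial>S)"
    by (simp only: nn_integral_eq_integral[OF int(1) nonneg(1)]
        nn_integral_eq_integral[OF int(2) nonneg(2)] nn_integral_eq_integral[OF int(3) nonneg(3)])
  moreover have "0 \<le> (\<integral>x. h x \<partial>\<mu>)" "0 \<le> (\<integral>x. h x \<partial>N)" "0 \<le> (\<integral>x. h x \<partial>S)"
    using nonneg by (simp_all add: integral_nonneg_AE)
  ultimately show ?thesis
    by (simp add: defs flip: ennreal_plus)
qed

lemma Var_le_second_moment:
  assumes "prob_space \<nu>" "integrable \<nu> f" "integrable \<nu> (\<lambda>x. (f x)\<^sup>2)"
  shows "Var \<nu> f \<le> (\<integral>x. (f x - m)\<^sup>2 \<partial>\<nu>)"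
proof -
  interpret prob_space \<nu> by fact
  have "(\<integral>x. (f x - m)\<^sup>2 \<partial>\<nu>) = (\<integral>x. (f x)\<^sup>2 - 2 * m * f x + m\<^sup>2 \<partial>\<nu>)"
    by (simp add: power2_diff algebra_simps)
  also have "\<dots> = (\<integral>x. (f x)\<^sup>2 \<partial>\<nu>) - 2 * m * (\<integral>x. f x \<partial>\<nu>) + m\<^sup>2"
    using assms(2,3) by (simp add: prob_space)
  also have "\<dots> = Var \<nu> f + ((\<integral>x. f x \<partial>\<nu>) - m)\<^sup>2"
    by (simp add: Var_def power2_diff algebra_simps)
  finally show ?thesis by simp
qed

lemma poincare_inequalityE:
  assumes "\<bar>poincare_const M \<nu>\<bar> \<noteq> \<infinity>"
  obtains C where "\<And>f. f \<in> C1 M \<Longrightarrow> Var \<nu> f \<le> C * (\<integral>x. grad_sq M f x \<partial>\<nu>)"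
proof -
  have "{C. \<forall>f\<in>C1 M. Var \<nu> f \<le> C * (\<integral>x. grad_sq M f x \<partial>\<nu>)} \<noteq> {}"
    using assms unfolding poincare_const_def by (metis Inf_empty abs_ereal.simps(3) image_empty top_ereal_def)
  then show ?thesis
    using that by blast
qed


section \<open>Compact operators on the Sobolev space\<close>

lemma integrable_square_of_Lp2: "u \<in> Lp 2 \<nu> \<Longrightarrow> integrable \<nu> (\<lambda>x. (u x)\<^sup>2)"
  by (simp add: Lp_def)

lemma Lp_norm_2: "Lp_norm 2 \<nu> u = sqrt (\<integral>x. (u x)\<^sup>2 \<partial>\<nu>)"
  by (simp add: Lp_norm_def powr_half_sqrt)

lemma integrable_square_diff:
  fixes u v :: "'a \<Rightarrow> real"
  assumes "u \<in> Lp 2 \<nu>" "v \<in> Lp 2 \<nu>"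
  shows "integrable \<nu> (\<lambda>x. (u x - v x)\<^sup>2)"
proof (rule Bochner_Integration.integrable_bound)
  show "integrable \<nu> (\<lambda>x. 2 * (u x)\<^sup>2 + 2 * (v x)\<^sup>2)"
    using assms by (simp add: integrable_square_of_Lp2)
  show "(\<lambda>x. (u x - v x)\<^sup>2) \<in> borel_measurable \<nu>"
    using assms by (auto simp: Lp_def)
  have "(a - b)\<^sup>2 \<le> 2 * a\<^sup>2 + 2 * b\<^sup>2" for a b :: real
    using sum_squares_bound[of a "-b"] by (simp add: power2_diff)
  then show "AE x in \<nu>. norm ((u x - v x)\<^sup>2) \<le> norm (2 * (u x)\<^sup>2 + 2 * (v x)\<^sup>2)"
    by (simp add: order_trans[OF _ abs_ge_self])
qed

text \<open>
  The constant sequence approximates \<open>f\<close>; the membership in \<open>L\<^sup>2\<close> holds because \<open>f\<close> and \<open>\<bar>\<nabla>f\<bar>\<^sup>2\<close> are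
  continuous on a compact space of finite measure.
\<close>

lemma C1_in_W12:
  fixes M :: "('m::topological_space, 'n::finite) riem"
  assumes M: "riemannian_manifold M" "compact (points M)"
    and \<nu>: "finite_measure \<nu>" "sets \<nu> = sets (restrict_space borel (points M))"
    and f: "f \<in> C1 M"
  shows "(f, gradient M f) \<in> W12 M \<nu>"
proof -
  note int = integrable_continuous_on_compact[OF \<nu> M(2) order_refl]
  note cf = C1_continuous_on[OF M(1) f]
  have space: "space \<nu> = points M"
    using sets_eq_imp_space_eq[OF \<nu>(2)] by (simp add: space_restrict_space)
  have "f \<in> Lp 2 \<nu>"
    using int[OF cf] int[OF continuous_on_power[OF cf, of 2]] by (auto simp: Lp_def)
  moreover have "gradient M f \<in> L2_field M \<nu>"
    using tangent_field_gradient[OF M(1) f] int[OF continuous_on_grad_sq[OF M(1) f]]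
      borel_measurable_continuous_on_restrict[OF continuous_on_gradient[OF M(1) f]]
    by (simp add: L2_field_def chart_domain_Int_points[OF M(1)])
  moreover have "(\<integral>\<^sup>+x. ennreal (field_normsq M (\<lambda>c p. gradient M f c p - gradient M f c p) x) \<partial>\<nu>) = 0"
    by (rule nn_integral_zero') (auto simp: field_normsq_zero[OF M(1)] space)
  ultimately show ?thesis
    using f by (auto simp: W12_def intro!: exI[of _ "\<lambda>_. f"])
qed

lemma W12_norm_C1:
  "W12_norm M \<nu> (f, gradient M f) = sqrt ((\<integral>x. (f x)\<^sup>2 \<partial>\<nu>) + (\<integral>x. grad_sq M f x \<partial>\<nu>))"
  by (simp add: W12_norm_def)

text \<open>
  A compact operator is bounded: otherwise one could rescale functions violating the bound with
  constant \<open>k\<close> so that they stay in the unit ball while the squared norms of their images equal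
  \<open>k\<close>, and no subsequence of the images would converge.
\<close>

lemma compact_trace_bounded:
  fixes M :: "('m::topological_space, 'n::finite) riem"
  assumes M: "riemannian_manifold M" "compact (points M)"
    and \<nu>: "finite_measure \<nu>" "sets \<nu> = sets (restrict_space borel (points M))"
    and trace: "compact_trace M \<nu> 2 \<rho>"
  obtains K where "0 \<le> K" "\<And>f. f \<in> C1 M \<Longrightarrow>
    (\<integral>x. (f x)\<^sup>2 \<partial>\<rho>) \<le> K * ((\<integral>x. (f x)\<^sup>2 \<partial>\<nu>) + (\<integral>x. grad_sq M f x \<partial>\<nu>))"
proof -
  have space: "space \<nu> = points M"
    using sets_eq_imp_space_eq[OF \<nu>(2)] by (simp add: space_restrict_space)
  obtain T where T: "W12_compact M \<nu> 2 \<rho> T"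
      "\<And>f. f \<in> C1 M \<Longrightarrow> AE x in \<rho>. T (f, gradient M f) x = f x"
    using trace unfolding compact_trace_def by blast
  define N where "N f = (\<integral>x. (f x)\<^sup>2 \<partial>\<nu>) + (\<integral>x. grad_sq M f x \<partial>\<nu>)" for f
  have N_nonneg: "0 \<le> N f" if "f \<in> C1 M" for f
    using grad_sq_nonneg[OF M(1) that] space
    by (auto simp: N_def intro!: add_nonneg_nonneg integral_nonneg_AE AE_I2)
  have "\<exists>k::nat. \<forall>f\<in>C1 M. (\<integral>x. (f x)\<^sup>2 \<partial>\<rho>) \<le> real k * N f"
  proof (rule ccontr)
    assume "\<not> ?thesis"
    then have "\<forall>k::nat. \<exists>f. f \<in> C1 M \<and> real k * N f < (\<integral>x. (f x)\<^sup>2 \<partial>\<rho>)"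
      by (auto simp: not_le)
    then obtain g where g: "\<And>k. g k \<in> C1 M" "\<And>k. real k * N (g k) < (\<integral>x. (g k x)\<^sup>2 \<partial>\<rho>)"
      by metis
    define s where "s k = (\<integral>x. (g k x)\<^sup>2 \<partial>\<rho>)" for k
    have s: "0 < s k" "real k * N (g k) < s k" for k
      using g(2)[of k] le_less_trans[OF mult_nonneg_nonneg[OF _ N_nonneg[OF g(1)]] g(2), of k]
      by (auto simp: s_def)
    define h where "h k = (\<lambda>x. sqrt (k / s k) * g k x + 0)" for k :: nat
    have sq: "(sqrt (k / s k))\<^sup>2 = k / s k" for k :: nat
      using s(1)[of k] by simp
    have h: "h k \<in> C1 M" for k
      unfolding h_def by (rule C1_affine[OF M(1) g(1)])
    have hsq: "(\<lambda>x. (h k x)\<^sup>2) = (\<lambda>x. k / s k * (g k x)\<^sup>2)" for k :: nat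
      unfolding h_def using sq[of k] by (auto simp: power_mult_distrib)
    have h_rho: "(\<integral>x. (h k x)\<^sup>2 \<partial>\<rho>) = k" for k
      unfolding hsq using s(1)[of k] by (simp flip: s_def)
    \<comment> \<open>A nonzero integral belongs to an integrable function.\<close>
    have h_meas: "(\<lambda>x. (h k x)\<^sup>2) \<in> borel_measurable \<rho>" for k
    proof -
      have "integrable \<rho> (\<lambda>x. (g k x)\<^sup>2)"
        using s(1)[of k] not_integrable_integral_eq unfolding s_def by fastforce
      then show ?thesis
        unfolding hsq by simp
    qed
    have "(\<integral>x. grad_sq M (h k) x \<partial>\<nu>) = (\<integral>x. k / s k * grad_sq M (g k) x \<partial>\<nu>)" for k
      unfolding h_def by (rule Bochner_Integration.integral_cong[OF refl])
        (simp add: grad_sq_affine[OF M(1) g(1)] space sq del: add_0_right)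
    then have "N (h k) = k / s k * N (g k)" for k
      unfolding N_def hsq by (simp add: distrib_left)
    then have "N (h k) \<le> 1" for k
      using s[of k] by (simp add: divide_le_eq)
    then have norm: "W12_norm M \<nu> (h k, gradient M (h k)) \<le> 1" for k
      unfolding W12_norm_C1 N_def by simp
    have "(\<forall>k. (h k, gradient M (h k)) \<in> W12 M \<nu>) \<and>
        (\<exists>K. \<forall>k. W12_norm M \<nu> (h k, gradient M (h k)) \<le> K)"
      using C1_in_W12[OF M \<nu> h] norm by blast
    with T(1) have "\<exists>r u. strict_mono r \<and> u \<in> Lp 2 \<rho> \<and>
        (\<lambda>k. Lp_norm 2 \<rho> (\<lambda>x. T (h (r k), gradient M (h (r k))) x - u x)) \<longlonglongrightarrow> 0"
      unfolding W12_compact_def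
      by (auto dest!: conjunct2 spec[of _ "\<lambda>k. (h k, gradient M (h k))"])
    then obtain r u where r: "strict_mono r" and u: "u \<in> Lp 2 \<rho>" and
      lim: "(\<lambda>k. Lp_norm 2 \<rho> (\<lambda>x. T (h (r k), gradient M (h (r k))) x - u x)) \<longlonglongrightarrow> 0"
      by blast
    let ?T = "\<lambda>k. T (h (r k), gradient M (h (r k)))"
    have TL: "?T k \<in> Lp 2 \<rho>" for k
      using T(1) C1_in_W12[OF M \<nu> h] by (auto simp: W12_compact_def W12_linear_def)
    have "\<forall>\<^sub>F k in sequentially. Lp_norm 2 \<rho> (\<lambda>x. ?T k x - u x) < 1"
      using order_tendstoD(2)[OF lim, of 1] by simp
    then obtain k0 where k0: "\<And>k. k0 \<le> k \<Longrightarrow> Lp_norm 2 \<rho> (\<lambda>x. ?T k x - u x) < 1"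
      unfolding eventually_sequentially by blast
    have bound: "real (r k) \<le> 2 + 2 * (\<integral>x. (u x)\<^sup>2 \<partial>\<rho>)" if "k0 \<le> k" for k
    proof -
      have "(\<integral>x. (?T k x - u x)\<^sup>2 \<partial>\<rho>) < 1"
        using k0[OF that] unfolding Lp_norm_2 by simp
      have "real (r k) = (\<integral>x. (?T k x)\<^sup>2 \<partial>\<rho>)"
        unfolding h_rho[of "r k", symmetric]
        by (rule integral_cong_AE)
           (use TL[of k] T(2)[OF h, of "r k"] h_meas[of "r k"] in \<open>auto simp: Lp_def\<close>)
      also have "\<dots> \<le> (\<integral>x. 2 * (?T k x - u x)\<^sup>2 + 2 * (u x)\<^sup>2 \<partial>\<rho>)"
      proof (rule integral_mono)
        have "a\<^sup>2 \<le> 2 * (a - b)\<^sup>2 + 2 * b\<^sup>2" for a b :: real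
          using zero_le_power2[of "a - 2 * b"] by (simp add: power2_eq_square algebra_simps)
        then show "(?T k x)\<^sup>2 \<le> 2 * (?T k x - u x)\<^sup>2 + 2 * (u x)\<^sup>2" for x .
      qed (use TL u in \<open>auto simp: integrable_square_of_Lp2 integrable_square_diff\<close>)
      also have "\<dots> = 2 * (\<integral>x. (?T k x - u x)\<^sup>2 \<partial>\<rho>) + 2 * (\<integral>x. (u x)\<^sup>2 \<partial>\<rho>)"
        using TL u by (simp add: integrable_square_of_Lp2 integrable_square_diff)
      finally show ?thesis
        using \<open>(\<integral>x. (?T k x - u x)\<^sup>2 \<partial>\<rho>) < 1\<close> by simp
    qed
    obtain k1 :: nat where k1: "2 + 2 * (\<integral>x. (u x)\<^sup>2 \<partial>\<rho>) < real k1"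
      using reals_Archimedean2 by blast
    have "real k1 \<le> real (r (max k0 k1))"
      using seq_suble[OF r, of "max k0 k1"] by simp
    with bound[of "max k0 k1"] k1 show False by simp
  qed
  then show ?thesis
    using that unfolding N_def by (metis of_nat_0_le_iff)
qed


section \<open>The Poincare inequality for the bulk-boundary measure\<close>

theorem proposition2p5:
  fixes \<Omega> :: "('m::t2_space, 'n::finite) riem"
    and \<Lambda> \<sigma> \<mu> :: "'m measure"
    and \<alpha> \<beta> :: "'m \<Rightarrow> real"
    and A B :: real
  assumes manifold: "riemannian_manifold \<Omega>" "compact (points \<Omega>)" "connected (points \<Omega>)"
    and bdry: "connected (boundary_points \<Omega>)"
    and dim: "CARD('n) \<ge> 2"
    and volume: "volume_measure \<Omega> \<Lambda>"
    and surface: "volume_measure (boundary \<Omega>) \<sigma>"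
    and A_def: "A = (\<integral>x. \<alpha> x \<partial>\<Lambda>)"
    and B_def: "B = (\<integral>x. \<beta> x \<partial>\<sigma>)"
    and mu_def: "\<mu> = bulk_boundary_measure \<Omega> \<Lambda> \<alpha> \<sigma> \<beta>"
    and prob: "prob_space \<mu>" "0 < A" "A < 1" "0 < B" "B < 1" "A + B = 1"
    and cont: "continuous_on (points \<Omega>) \<alpha>" "continuous_on (points \<Omega>) \<beta>"
    and pos: "AE x in \<Lambda>. 0 < \<alpha> x" "AE x in \<sigma>. 0 < \<beta> x"
    and sqrt_alpha: "\<exists>V. ((\<lambda>x. sqrt (\<alpha> x)), V) \<in> W12 \<Omega> \<Lambda>"
    and sqrt_beta: "\<exists>V. ((\<lambda>x. sqrt (\<beta> x)), V) \<in> W12 (boundary \<Omega>) \<sigma>"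
    and poincare_bulk: "\<bar>poincare_const \<Omega> (weighted \<Lambda> (\<lambda>x. \<alpha> x / A))\<bar> \<noteq> \<infinity>"
    and log_sobolev_bulk: "\<bar>log_sobolev_const \<Omega> (weighted \<Lambda> (\<lambda>x. \<alpha> x / A))\<bar> \<noteq> \<infinity>"
    and poincare_bdry: "\<bar>poincare_const (boundary \<Omega>) (weighted \<sigma> (\<lambda>x. \<beta> x / B))\<bar> \<noteq> \<infinity>"
    and log_sobolev_bdry: "\<bar>log_sobolev_const (boundary \<Omega>) (weighted \<sigma> (\<lambda>x. \<beta> x / B))\<bar> \<noteq> \<infinity>"
    and embed_bulk: "compactly_embedded \<Omega> (weighted \<Lambda> \<alpha>) 2 (weighted \<Lambda> \<alpha>)"
    and embed_Lp: "\<And>p::real. 2 \<le> p \<Longrightarrow>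
          CARD('n) = 2 \<or> p \<le> (2 * real CARD('n) - 2) / (real CARD('n) - 2) \<Longrightarrow>
          continuously_embedded \<Omega> (weighted \<Lambda> \<alpha>) p (weighted \<Lambda> \<beta>)"
    and embed_bdry: "compactly_embedded (boundary \<Omega>) (weighted \<sigma> \<beta>) 2 (weighted \<sigma> \<beta>)"
    and trace: "compact_trace \<Omega> (weighted \<Lambda> \<alpha>) 2 (weighted \<sigma> \<beta>)"
  shows "\<exists>C::real. \<forall>f\<in>C1 \<Omega>. Var \<mu> f \<le> C * (\<integral>x. grad_sq \<Omega> f x * \<alpha> x \<partial>\<Lambda>)"
proof -
  let ?X = "points \<Omega>"
  let ?N = "weighted \<Lambda> \<alpha>"
  let ?S = "weighted \<sigma> \<beta>"
  let ?P = "weighted \<Lambda> (\<lambda>x. \<alpha> x / A)"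
  have sets_\<Lambda>: "sets \<Lambda> = sets (restrict_space borel ?X)"
    using volume by (simp add: volume_measure_def)
  have sets_\<sigma>: "sets \<sigma> = sets (restrict_space borel (boundary_points \<Omega>))"
    using surface by (simp add: volume_measure_def boundary_def)
  have bdry_sub: "boundary_points \<Omega> \<subseteq> ?X"
    using charts_cover[OF manifold(1)] by (auto simp: boundary_points_def)
  have space_\<Lambda>: "space \<Lambda> = ?X"
    using sets_eq_imp_space_eq[OF sets_\<Lambda>] by (simp add: space_restrict_space)
  \<comment> \<open>A function that is not integrable has integral 0, while \<open>A\<close> and \<open>B\<close> are positive.\<close>
  have int_weights: "integrable \<Lambda> \<alpha>" "integrable \<sigma> \<beta>"
    using prob(2,4) A_def B_def not_integrable_integral_eq by fastforce+
  note fin = finite_measure_weighted[OF int_weights(1)] finite_measure_weighted[OF int_weights(2)]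
  have fin_\<mu>: "finite_measure \<mu>"
    using prob(1) by (rule prob_space.finite_measure)
  have sets_\<mu>: "sets \<mu> = sets (restrict_space borel ?X)"
    unfolding mu_def bulk_boundary_measure_def
    using sets.sets_measure_of_eq[of "restrict_space borel ?X"] by (simp add: space_restrict_space)
  have int_N: "integrable ?N h" if "continuous_on ?X h" for h :: "'m \<Rightarrow> real"
    using integrable_continuous_on_compact[OF fin(1) _ manifold(2) order_refl that] sets_\<Lambda> by simp
  have int_\<mu>: "integrable \<mu> h" if "continuous_on ?X h" for h :: "'m \<Rightarrow> real"
    using integrable_continuous_on_compact[OF fin_\<mu> sets_\<mu> manifold(2) order_refl that] .
  have integral_N: "(\<integral>x. h x \<partial>?N) = (\<integral>x. h x * \<alpha> x \<partial>\<Lambda>)"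
    and integral_P: "(\<integral>x. h x \<partial>?P) = (\<integral>x. h x \<partial>?N) / A"
    if "continuous_on ?X h" for h :: "'m \<Rightarrow> real"
  proof -
    have h: "h \<in> borel_measurable \<Lambda>"
      using borel_measurable_continuous_on_restrict[OF that]
      by (simp add: measurable_cong_sets[OF sets_\<Lambda> refl])
    have nonneg: "AE x in \<Lambda>. 0 \<le> \<alpha> x" "AE x in \<Lambda>. 0 \<le> \<alpha> x / A"
      using pos(1) prob(2) by (auto elim!: eventually_mono)
    show eq: "(\<integral>x. h x \<partial>?N) = (\<integral>x. h x * \<alpha> x \<partial>\<Lambda>)"
      using integral_weighted[OF h _ nonneg(1)] int_weights(1) by simp
    show "(\<integral>x. h x \<partial>?P) = (\<integral>x. h x \<partial>?N) / A"
      using integral_weighted[OF h _ nonneg(2)] int_weights(1) by (simp add: eq)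
  qed
  have mass_N: "(\<integral>x. 1 \<partial>?N) = A"
    using integral_N[of "\<lambda>_. 1"] A_def by simp
  obtain C0 where C0: "\<And>f. f \<in> C1 \<Omega> \<Longrightarrow> Var ?P f \<le> C0 * (\<integral>x. grad_sq \<Omega> f x \<partial>?P)"
    using poincare_inequalityE[OF poincare_bulk] by blast
  obtain K where K: "0 \<le> K" "\<And>f. f \<in> C1 \<Omega> \<Longrightarrow>
      (\<integral>x. (f x)\<^sup>2 \<partial>?S) \<le> K * ((\<integral>x. (f x)\<^sup>2 \<partial>?N) + (\<integral>x. grad_sq \<Omega> f x \<partial>?N))"
    using compact_trace_bounded[OF manifold(1,2) fin(1) _ trace] sets_\<Lambda> by auto
  have "Var \<mu> f \<le> (C0 + K * (C0 + 1)) * (\<integral>x. grad_sq \<Omega> f x * \<alpha> x \<partial>\<Lambda>)" if f: "f \<in> C1 \<Omega>" for f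
  proof -
    define m where "m = (\<integral>x. f x \<partial>?P)"
    define g where "g = (\<lambda>x. f x - m)"
    define I where "I = (\<integral>x. grad_sq \<Omega> f x \<partial>?N)"
    note cf = C1_continuous_on[OF manifold(1) f]
    have g: "g \<in> C1 \<Omega>"
      unfolding g_def using C1_affine[OF manifold(1) f, of 1 "- m"] by simp
    note cg = C1_continuous_on[OF manifold(1) g]
    note cg2 = continuous_on_power[OF cg, of 2]
    have "grad_sq \<Omega> g x = grad_sq \<Omega> f x" if "x \<in> ?X" for x
      unfolding g_def using grad_sq_affine[OF manifold(1) f that, of 1 "- m"] by simp
    then have grad_g: "(\<integral>x. grad_sq \<Omega> g x \<partial>?N) = I"
      unfolding I_def using space_\<Lambda>
      by (intro Bochner_Integration.integral_cong refl) (simp add: weighted_def)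
    have "(\<integral>x. g x \<partial>?N) = (\<integral>x. f x \<partial>?N) - m * A"
      unfolding g_def using int_N[OF cf] int_N[of "\<lambda>_. 1"] int_N[of "\<lambda>_. m"] mass_N by simp
    then have mean_g: "(\<integral>x. g x \<partial>?P) = 0"
      using integral_P[OF cg] integral_P[OF cf] prob(2) by (simp add: m_def)
    \<comment> \<open>Since \<open>g\<close> has mean zero, its variance is its second moment.\<close>
    have "(\<integral>x. (g x)\<^sup>2 \<partial>?N) / A \<le> C0 * (I / A)"
      using C0[OF g] integral_P[OF cg2] integral_P[OF continuous_on_grad_sq[OF manifold(1) g]]
      by (simp add: Var_def mean_g grad_g)
    then have bulk: "(\<integral>x. (g x)\<^sup>2 \<partial>?N) \<le> C0 * I"
      using prob(2) by (simp add: divide_le_cancel)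
    have "Var \<mu> f \<le> (\<integral>x. (f x - m)\<^sup>2 \<partial>\<mu>)"
      using Var_le_second_moment[OF prob(1) int_\<mu>[OF cf] int_\<mu>[OF continuous_on_power[OF cf]]] .
    also have "\<dots> = (\<integral>x. (g x)\<^sup>2 \<partial>\<mu>)"
      by (simp add: g_def)
    also have "\<dots> = (\<integral>x. (g x)\<^sup>2 \<partial>?N) + (\<integral>x. (g x)\<^sup>2 \<partial>?S)"
      unfolding mu_def using fin_\<mu> mu_def
      by (intro integral_bulk_boundary sets_\<Lambda> sets_\<sigma> fin bdry_sub manifold(2) cg2) auto
    also have "\<dots> \<le> C0 * I + K * (C0 * I + I)"
    proof (rule add_mono[OF bulk])
      have "(\<integral>x. (g x)\<^sup>2 \<partial>?S) \<le> K * ((\<integral>x. (g x)\<^sup>2 \<partial>?N) + I)"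
        using K(2)[OF g] by (simp add: grad_g)
      also have "\<dots> \<le> K * (C0 * I + I)"
        using bulk by (intro mult_left_mono K(1)) simp
      finally show "(\<integral>x. (g x)\<^sup>2 \<partial>?S) \<le> K * (C0 * I + I)" .
    qed
    also have "\<dots> = (C0 + K * (C0 + 1)) * I"
      by (simp add: algebra_simps)
    finally show ?thesis
      unfolding I_def integral_N[OF continuous_on_grad_sq[OF manifold(1) f]] .
  qed
  then show ?thesis by blast
qed

end
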